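(* Let $\Phi$ be a domain with $|\Phi|=n$. There is a $\mathrm{PL}(\{\wedge,{\sim},\mathbin{\dot\vee}\})$-formula $\varphi$ of length $O(n^2)$ such that for every $\Phi$-team $T$: $T\models\varphi$ iff $|T|$ is odd.
   Context: A domain $\Phi$ is a finite set of propositional variables; a $\Phi$-assignment is a map $s:\Phi\to\{0,1\}$; a $\Phi$-team is a (possibly empty) set of $\Phi$-assignments. A strict split of $T$ is a pair $(T_1,T_2)$ with $T_1\cup T_2=T$ and $T_1\cap T_2=\emptyset$. $\mathrm{PL}(\{\wedge,{\sim},\mathbin{\dot\vee}\})$ is the set of formulas built from the literals $\top,\bot,p,\neg p$ ($p\in\Phi$) using $\wedge$, ${\sim}$ (applicable to any formula) and $\mathbin{\dot\vee}$. Semantics: $T\models\top$ always; $T\models\bot$ iff $T=\emptyset$; $T\models p$ iff $s(p)=1$ for all $s\in T$; $T\models\neg p$ iff $s(p)=0$ for all $s\in T$; $T\models{\sim}\psi$ iff $T\not\models\psi$; $\wedge$ is conjunction; $T\models\psi\mathbin{\dot\vee}\theta$ iff there is a strict split $(S,U)$ of $T$ with $S\models\psi$ and $U\models\theta$. Length = length as a string, each variable counting as one symbol. *)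

theory Defs
  imports Complex_Main "HOL-Library.FuncSet" "HOL-Library.Landau_Symbols"
begin

text \<open>The truth values 0 and 1 are rendered as \<^term>\<open>False\<close> and \<^term>\<open>True\<close>.
  Assignments are extensional functions, so that distinct elements of a team
  differ on the domain and \<^const>\<open>card\<close> counts them correctly.\<close>

definition assignments :: "'v set \<Rightarrow> ('v \<Rightarrow> bool) set" where
  "assignments \<Phi> = \<Phi> \<rightarrow>\<^sub>E UNIV"

definition is_team :: "'v set \<Rightarrow> ('v \<Rightarrow> bool) set \<Rightarrow> bool" where
  "is_team \<Phi> T \<longleftrightarrow> T \<subseteq> assignments \<Phi>"

definition strict_split :: "'s set \<Rightarrow> 's set \<Rightarrow> 's set \<Rightarrow> bool" where
  "strict_split T T1 T2 \<longleftrightarrow> T1 \<union> T2 = T \<and> T1 \<inter> T2 = {}"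

datatype (vars: 'v) fm =
    Top
  | Bot
  | Var 'v
  | NegVar 'v
  | Conj "'v fm" "'v fm"
  | CNeg "'v fm"
  | SDisj "'v fm" "'v fm"

definition PL :: "'v set \<Rightarrow> 'v fm set" where
  "PL \<Phi> = {\<phi>. vars \<phi> \<subseteq> \<Phi>}"

primrec sat :: "('v \<Rightarrow> bool) set \<Rightarrow> 'v fm \<Rightarrow> bool" (infix "\<Turnstile>" 50) where
  "T \<Turnstile> Top \<longleftrightarrow> True"
| "T \<Turnstile> Bot \<longleftrightarrow> T = {}"
| "T \<Turnstile> Var p \<longleftrightarrow> (\<forall>s\<in>T. s p = True)"
| "T \<Turnstile> NegVar p \<longleftrightarrow> (\<forall>s\<in>T. s p = False)"
| "T \<Turnstile> Conj \<psi> \<theta> \<longleftrightarrow> T \<Turnstile> \<psi> \<and> T \<Turnstile> \<theta>"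
| "T \<Turnstile> CNeg \<psi> \<longleftrightarrow> \<not> T \<Turnstile> \<psi>"
| "T \<Turnstile> SDisj \<psi> \<theta> \<longleftrightarrow> (\<exists>S U. strict_split T S U \<and> S \<Turnstile> \<psi> \<and> U \<Turnstile> \<theta>)"

text \<open>Formulas as strings: binary connectives are infix and fully parenthesised,
  and parentheses count as symbols.\<close>

datatype 'v symb =
  STop | SBot | SVar 'v | SNot | SAnd | STilde | SDotOr | SLParen | SRParen

primrec string_of :: "'v fm \<Rightarrow> 'v symb list" where
  "string_of Top = [STop]"
| "string_of Bot = [SBot]"
| "string_of (Var p) = [SVar p]"
| "string_of (NegVar p) = [SNot, SVar p]"
| "string_of (Conj \<psi> \<theta>) = [SLParen] @ string_of \<psi> @ [SAnd] @ string_of \<theta> @ [SRParen]"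
| "string_of (CNeg \<psi>) = [STilde] @ string_of \<psi>"
| "string_of (SDisj \<psi> \<theta>) = [SLParen] @ string_of \<psi> @ [SDotOr] @ string_of \<theta> @ [SRParen]"

definition fm_length :: "'v fm \<Rightarrow> nat" where
  "fm_length \<phi> = length (string_of \<phi>)"

end

theory Submission imports Defs begin

text \<open>Call a team separated by a list \<open>ps\<close> of variables if distinct members differ on some
  variable of \<open>ps\<close>. A team separated by \<open>p # ps\<close> has, modulo agreement on \<open>ps\<close>, classes of size
  at most two. Split off the two-element classes: this removes an even number of members and
  leaves a team separated by \<open>ps\<close>, so parity is computed by recursion on the list, and the
  recursive formula is used only once. Separation is expressible in linear length: no subteam
  with at least two members is constant on \<open>ps\<close>. The difficulty is to say that a team consists
  of two-element classes, because after a split the two parts cannot be compared. A member \<open>s\<close>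
  with \<open>s p\<close> true has no partner iff removing the other members where \<open>p\<close> is true leaves a team
  separated by \<open>ps\<close>; this split can be described because \<open>p\<close> marks \<open>s\<close>. There are \<open>n\<close> levels
  of linear length each.\<close>

definition agree_on :: "'v list \<Rightarrow> ('v \<Rightarrow> bool) \<Rightarrow> ('v \<Rightarrow> bool) \<Rightarrow> bool" where
  "agree_on ps s t \<longleftrightarrow> (\<forall>p\<in>set ps. s p = t p)"

definition separated :: "'v list \<Rightarrow> ('v \<Rightarrow> bool) set \<Rightarrow> bool" where
  "separated ps T \<longleftrightarrow> (\<forall>s\<in>T. \<forall>t\<in>T. agree_on ps s t \<longrightarrow> s = t)"

lemma agree_on_Nil [simp]: "agree_on [] s t"
  by (simp add: agree_on_def)

lemma agree_on_Cons [simp]: "agree_on (p # ps) s t \<longleftrightarrow> s p = t p \<and> agree_on ps s t"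
  by (simp add: agree_on_def)

lemma agree_on_sym: "agree_on ps s t \<Longrightarrow> agree_on ps t s"
  by (simp add: agree_on_def)

text \<open>Presents agreement as equality of images under one function, so that classes can be
  counted with \<open>inj_on\<close>.\<close>

lemma agree_on_iff_restrict: "agree_on ps s t \<longleftrightarrow> restrict s (set ps) = restrict t (set ps)"
  by (auto simp: agree_on_def restrict_def fun_eq_iff)

lemma separated_subset: "separated ps T \<Longrightarrow> S \<subseteq> T \<Longrightarrow> separated ps S"
  by (auto simp: separated_def)

text \<open>Two nonempty disjoint parts force at least two members. The nested \<open>CNeg\<close>
  is Boolean disjunction on the whole team, by De Morgan.\<close>

primrec constant_pair_fm :: "'v list \<Rightarrow> 'v fm" where
  "constant_pair_fm [] = SDisj (CNeg Bot) (CNeg Bot)"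
| "constant_pair_fm (p # ps) = Conj (CNeg (Conj (CNeg (Var p)) (CNeg (NegVar p)))) (constant_pair_fm ps)"

text \<open>\<open>SDisj Top\<close> quantifies over subteams, since the complement is
  unconstrained.\<close>

definition separated_fm :: "'v list \<Rightarrow> 'v fm" where
  "separated_fm ps = CNeg (SDisj Top (constant_pair_fm ps))"

text \<open>One conjunct for each value of \<open>p\<close> excludes a partnerless member. The
  intended meaning holds only on teams separated by \<open>p # ps\<close>.\<close>

definition paired_fm :: "'v \<Rightarrow> 'v list \<Rightarrow> 'v fm" where
  "paired_fm p ps = Conj
     (CNeg (SDisj (Var p) (Conj (separated_fm ps) (CNeg (NegVar p)))))
     (CNeg (SDisj (NegVar p) (Conj (separated_fm ps) (CNeg (Var p)))))"

primrec parity_fm :: "'v list \<Rightarrow> 'v fm" where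
  "parity_fm [] = CNeg Bot"
| "parity_fm (p # ps) = SDisj (paired_fm p ps) (Conj (separated_fm ps) (parity_fm ps))"

lemma sat_constant_pair_fm:
  "T \<Turnstile> constant_pair_fm ps \<longleftrightarrow> (\<exists>s\<in>T. \<exists>t\<in>T. s \<noteq> t) \<and> (\<forall>s\<in>T. \<forall>t\<in>T. agree_on ps s t)"
proof (induction ps)
  case Nil
  have "\<exists>S U. strict_split T S U \<and> S \<noteq> {} \<and> U \<noteq> {}" if "s \<in> T" "t \<in> T" "s \<noteq> t" for s t
    using that by (intro exI[of _ "{s}"] exI[of _ "T - {s}"]) (auto simp: strict_split_def)
  moreover have "\<exists>s\<in>T. \<exists>t\<in>T. s \<noteq> t" if "strict_split T S U" "S \<noteq> {}" "U \<noteq> {}" for S U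
  proof -
    obtain s t where "s \<in> S" "t \<in> U"
      using \<open>S \<noteq> {}\<close> \<open>U \<noteq> {}\<close> by blast
    moreover from this have "s \<in> T" "t \<in> T" "s \<noteq> t"
      using \<open>strict_split T S U\<close> by (auto simp: strict_split_def)
    ultimately show ?thesis
      by blast
  qed
  ultimately show ?case
    by (simp, blast)
next
  case (Cons p ps)
  have "\<not> (\<not> (\<forall>s\<in>T. s p = True) \<and> \<not> (\<forall>s\<in>T. s p = False)) \<longleftrightarrow>
      (\<forall>s\<in>T. \<forall>t\<in>T. s p = t p)"
    by blast
  then show ?case
    unfolding constant_pair_fm.simps sat.simps Cons.IH agree_on_Cons ball_conj_distrib by argo
qed

lemma sat_separated_fm: "T \<Turnstile> separated_fm ps \<longleftrightarrow> separated ps T"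
proof
  assume *: "T \<Turnstile> separated_fm ps"
  show "separated ps T"
    unfolding separated_def
  proof (intro ballI impI, rule ccontr)
    fix s t assume st: "s \<in> T" "t \<in> T" "agree_on ps s t" "s \<noteq> t"
    then have "strict_split T (T - {s, t}) {s, t}" "{s, t} \<Turnstile> constant_pair_fm ps"
      by (auto simp: strict_split_def sat_constant_pair_fm agree_on_def)
    with * show False
      by (auto simp: separated_fm_def)
  qed
next
  assume "separated ps T"
  then show "T \<Turnstile> separated_fm ps"
    by (fastforce simp: separated_fm_def separated_def strict_split_def sat_constant_pair_fm)
qed

text \<open>A partner of \<open>s\<close> differs from it at \<open>p\<close>, so it cannot lie in
  \<open>S\<close>; in \<open>U\<close> it would violate separation by \<open>ps\<close>.\<close>

lemma no_partner_iff_split: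
  fixes b :: bool
  assumes "separated (p # ps) T"
  shows "(\<exists>S U. strict_split T S U \<and> (\<forall>s\<in>S. s p = b) \<and> separated ps U \<and> (\<exists>s\<in>U. s p = b))
    \<longleftrightarrow> (\<exists>s\<in>T. s p = b \<and> (\<forall>t\<in>T. agree_on ps s t \<longrightarrow> t = s))" (is "?L \<longleftrightarrow> ?R")
proof
  assume ?L
  then obtain S U s where *: "strict_split T S U" "\<forall>s\<in>S. s p = b" "separated ps U" "s \<in> U" "s p = b"
    by blast
  have "t = s" if t: "t \<in> T" "agree_on ps s t" for t
  proof (cases "t \<in> U")
    case True
    then show ?thesis
      using *(3,4) t(2) unfolding separated_def by blast
  next
    case False
    then have "s \<in> T" "t p = s p"
      using * t(1) by (auto simp: strict_split_def)
    then show ?thesis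
      using assms t unfolding separated_def agree_on_Cons by metis
  qed
  moreover have "s \<in> T"
    using * by (auto simp: strict_split_def)
  ultimately show ?R
    using *(5) by blast
next
  assume ?R
  then obtain s where s: "s \<in> T" "s p = b" "\<And>t. t \<in> T \<Longrightarrow> agree_on ps s t \<Longrightarrow> t = s"
    by blast
  \<comment> \<open>The least possible \<open>U\<close> containing \<open>s\<close>: members with
    the other value at \<open>p\<close> are not allowed in \<open>S\<close>.\<close>
  define U where "U = insert s {t \<in> T. t p \<noteq> b}"
  have "separated ps U"
    unfolding separated_def
  proof (intro ballI impI)
    fix t u assume tu: "t \<in> U" "u \<in> U" "agree_on ps t u"
    then have T: "t \<in> T" "u \<in> T"
      using s(1) by (auto simp: U_def)
    show "t = u"
    proof (cases "t = s \<or> u = s")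
      case True
      then show ?thesis
        using s(3) T tu(3) agree_on_sym by metis
    next
      case False
      then have "t p = u p"
        using tu(1,2) by (auto simp: U_def)
      then show ?thesis
        using assms T tu(3) by (simp add: separated_def)
    qed
  qed
  moreover have "strict_split T (T - U) U" "\<forall>t\<in>T - U. t p = b"
    using s by (auto simp: strict_split_def U_def)
  moreover have "s \<in> U"
    by (simp add: U_def)
  ultimately show ?L
    using s(2) by blast
qed

lemma sat_paired_fm:
  assumes "separated (p # ps) T"
  shows "T \<Turnstile> paired_fm p ps \<longleftrightarrow> (\<forall>s\<in>T. \<exists>t\<in>T. agree_on ps s t \<and> t \<noteq> s)"
proof -
  have "T \<Turnstile> paired_fm p ps \<longleftrightarrow>
      \<not> (\<exists>s\<in>T. s p = True \<and> (\<forall>t\<in>T. agree_on ps s t \<longrightarrow> t = s)) \<and>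
      \<not> (\<exists>s\<in>T. s p = False \<and> (\<forall>t\<in>T. agree_on ps s t \<longrightarrow> t = s))"
    unfolding no_partner_iff_split[OF assms, symmetric]
    by (simp add: paired_fm_def sat_separated_fm)
  then show ?thesis
    by auto
qed

text \<open>Partners take opposite values at \<open>p\<close>, so the two halves given by
  \<open>p\<close> have the same restrictions to \<open>ps\<close>, each attained once per
  half.\<close>

lemma even_card_paired:
  assumes "finite T" "separated (p # ps) T"
    and paired: "\<forall>s\<in>T. \<exists>t\<in>T. agree_on ps s t \<and> t \<noteq> s"
  shows "even (card T)"
proof -
  let ?r = "\<lambda>s. restrict s (set ps)"
  define A where "A b = {s \<in> T. s p = b}" for b
  have inj: "inj_on ?r (A b)" for b
    using assms(2) by (auto simp: inj_on_def A_def separated_def simp flip: agree_on_iff_restrict)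
  have sub: "?r ` A b \<subseteq> ?r ` A (\<not> b)" for b
  proof
    fix x assume "x \<in> ?r ` A b"
    then obtain s where s: "s \<in> T" "s p = b" "x = ?r s"
      by (auto simp: A_def)
    with paired obtain t where t: "t \<in> T" "agree_on ps s t" "t \<noteq> s"
      by blast
    with s assms(2) have "t \<in> A (\<not> b)"
      by (auto simp: separated_def A_def)
    with s t show "x \<in> ?r ` A (\<not> b)"
      by (auto simp: agree_on_iff_restrict)
  qed
  have "card (A True) = card (A False)"
  proof -
    have "?r ` A True = ?r ` A False"
      using sub[of True] sub[of False] by auto
    then show ?thesis
      using card_image[OF inj[of True]] card_image[OF inj[of False]] by simp
  qed
  moreover have "card T = card (A True) + card (A False)"
  proof -
    have "T = A True \<union> A False" "A True \<inter> A False = {}"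
      by (auto simp: A_def)
    then show ?thesis
      using assms(1) by (metis card_Un_disjoint finite_Un)
  qed
  ultimately show ?thesis
    by simp
qed

lemma sat_parity_fm:
  assumes "finite T" "separated ps T"
  shows "T \<Turnstile> parity_fm ps \<longleftrightarrow> odd (card T)"
  using assms
proof (induction ps arbitrary: T)
  case Nil
  then have "T = {} \<or> (\<exists>s. T = {s})"
    unfolding separated_def using agree_on_Nil by blast
  then show ?case
    by auto
next
  case (Cons p ps)
  \<comment> \<open>Every admissible split gives the same parity, so the existential choice in
    \<open>SDisj\<close> cannot produce a wrong answer.\<close>
  have parity: "U \<Turnstile> parity_fm ps \<longleftrightarrow> odd (card T)"
    if split: "strict_split T S U" and S: "S \<Turnstile> paired_fm p ps" and U: "separated ps U" for S U
  proof -
    have sub: "S \<subseteq> T" "U \<subseteq> T" and fin: "finite S" "finite U"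
      using split Cons.prems(1) by (auto simp: strict_split_def)
    have sep: "separated (p # ps) S"
      using Cons.prems(2) sub(1) by (rule separated_subset)
    have "even (card S)"
      using even_card_paired[OF fin(1) sep] S sat_paired_fm[OF sep] by blast
    moreover have "card T = card S + card U"
      using split fin by (auto simp: strict_split_def card_Un_disjoint)
    ultimately show ?thesis
      using Cons.IH[OF fin(2) U] by simp
  qed
  \<comment> \<open>An admissible split exists: having a partner is symmetric, so \<open>S\<close>
    keeps pairs whole and no member of the rest has a partner.\<close>
  define S where "S = {s \<in> T. \<exists>t\<in>T. agree_on ps s t \<and> t \<noteq> s}"
  have split: "strict_split T S (T - S)"
    by (auto simp: strict_split_def S_def)
  have "separated (p # ps) S"
    using Cons.prems(2) by (rule separated_subset) (auto simp: S_def)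
  moreover have "\<forall>s\<in>S. \<exists>t\<in>S. agree_on ps s t \<and> t \<noteq> s"
    unfolding S_def using agree_on_sym by blast
  ultimately have S: "S \<Turnstile> paired_fm p ps"
    by (simp add: sat_paired_fm)
  have U: "separated ps (T - S)"
    by (auto simp: separated_def S_def)
  show ?case
    unfolding parity_fm.simps sat.simps sat_separated_fm
    using parity parity[OF split S U] split S U by blast
qed

lemma vars_constant_pair_fm: "vars (constant_pair_fm ps) = set ps"
  by (induction ps) auto

lemma vars_parity_fm: "vars (parity_fm ps) \<subseteq> set ps"
  by (induction ps) (auto simp: paired_fm_def separated_fm_def vars_constant_pair_fm)

lemma fm_length_constant_pair_fm: "fm_length (constant_pair_fm ps) = 12 * length ps + 7"
  by (induction ps) (auto simp: fm_length_def)

text \<open>The 36 comes from three copies of \<open>separated_fm ps\<close>, each with 12 symbols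
  per variable.\<close>

lemma fm_length_parity_fm_Cons:
  "fm_length (parity_fm (p # ps)) = fm_length (parity_fm ps) + 36 * length ps + 67"
  using fm_length_constant_pair_fm[of ps]
  by (simp add: fm_length_def paired_fm_def separated_fm_def)

lemma fm_length_parity_fm: "fm_length (parity_fm ps) \<le> 67 * (length ps)\<^sup>2 + 67 * length ps + 2"
proof (induction ps)
  case Nil
  then show ?case by (simp add: fm_length_def)
next
  case (Cons p ps)
  then show ?case
    unfolding fm_length_parity_fm_Cons by (simp add: power2_eq_square)
qed

theorem theorem4p10:
  "\<exists>L :: nat \<Rightarrow> nat.
     (\<lambda>n. real (L n)) \<in> O(\<lambda>n. real n ^ 2) \<and>
     (\<forall>(\<Phi> :: 'v set) n. finite \<Phi> \<and> card \<Phi> = n \<longrightarrow>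
        (\<exists>\<phi> \<in> PL \<Phi>. fm_length \<phi> \<le> L n \<and>
           (\<forall>T. is_team \<Phi> T \<longrightarrow> (T \<Turnstile> \<phi> \<longleftrightarrow> odd (card T)))))"
proof (intro exI conjI allI impI)
  let ?L = "\<lambda>n :: nat. 67 * n\<^sup>2 + 67 * n + 2"
  show "(\<lambda>n. real (?L n)) \<in> O(\<lambda>n. real n ^ 2)"
  proof (rule bigoI[of _ 136], rule eventually_sequentiallyI[of 1])
    fix n :: nat assume "1 \<le> n"
    \<comment> \<open>136 = 67 + 67 + 2, as both \<open>n\<close> and 1 are at most
      \<open>n^2\<close>.\<close>
    then have "?L n \<le> 136 * n\<^sup>2"
      using self_le_power[of n 2] one_le_power[of n 2] by linarith
    then have "real (?L n) \<le> real (136 * n\<^sup>2)"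
      by (rule of_nat_mono)
    then show "norm (real (?L n)) \<le> 136 * norm (real n ^ 2)"
      by simp
  qed
  fix \<Phi> :: "'v set" and n
  assume "finite \<Phi> \<and> card \<Phi> = n"
  then obtain ps where ps: "set ps = \<Phi>" "length ps = n"
    using finite_distinct_list[of \<Phi>] distinct_card by metis
  show "\<exists>\<phi>\<in>PL \<Phi>. fm_length \<phi> \<le> ?L n \<and> (\<forall>T. is_team \<Phi> T \<longrightarrow> (T \<Turnstile> \<phi> \<longleftrightarrow> odd (card T)))"
  proof (intro bexI[of _ "parity_fm ps"] conjI allI impI)
    show "parity_fm ps \<in> PL \<Phi>"
      using vars_parity_fm[of ps] ps by (simp add: PL_def)
    show "fm_length (parity_fm ps) \<le> ?L n"
      using fm_length_parity_fm[of ps] ps by simp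
    fix T assume "is_team \<Phi> T"
    then have T: "T \<subseteq> \<Phi> \<rightarrow>\<^sub>E UNIV"
      by (simp add: is_team_def assignments_def)
    have "finite T"
      using T by (rule finite_subset) (use ps in \<open>auto intro: finite_PiE\<close>)
    \<comment> \<open>Extensionality makes assignments that agree on all of \<open>ps\<close> equal,
      so the recursion may start from any team.\<close>
    moreover have "separated ps T"
      unfolding separated_def
    proof (intro ballI impI)
      fix s t assume "s \<in> T" "t \<in> T" "agree_on ps s t"
      with T ps show "s = t"
        by (intro PiE_ext[of s \<Phi> "\<lambda>_. UNIV" t]) (auto simp: agree_on_def)
    qed
    ultimately show "T \<Turnstile> parity_fm ps \<longleftrightarrow> odd (card T)"
      by (rule sat_parity_fm)
  qed
qed

end
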